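(* Let $\sigma\in\mathcal{S}_{\mathrm{admis}}$ be an admissible switching signal, let $\mathcal{G}(t)=\Gamma(\mathsf{A}_{\sigma(t)})$ for $t\ge0$, and let $L_{\sigma(t)}$ be the Laplacian of $\mathcal{G}(t)$. Then for any $\alpha,\beta>0$, the trajectory of $$\dot y=-\alpha y-\beta L_{\sigma(t)}y-w,\qquad \dot w=\alpha\beta L_{\sigma(t)}y,$$ starting from any initial condition $y(0),w(0)\in\mathbb{R}^N$ satisfies, for all $i\in\{1,\dots,N\}$, $$y^i(t)\to-\frac{\alpha^{-1}}{N}\sum_{j=1}^N w^j(0),\qquad w^i(t)\to\frac1N\sum_{j=1}^N w^j(0),\qquad\text{as }t\to\infty,$$ exponentially fast.
   Context: Weighted digraphs on nodes $\{1,\dots,N\}$, $N\ge2$: for an adjacency matrix $\mathsf{A}=[a_{ij}]$ with nonnegative entries, $\Gamma(\mathsf{A})$ is the weighted digraph with edge $(i,j)$ iff $a_{ij}>0$. Weight-balanced: $\sum_j a_{ij}=\sum_j a_{ji}$ for every $i$. Laplacian: $L=D^{\rm out}-\mathsf{A}$, where $D^{\rm out}$ is diagonal with entries $\sum_j a_{ij}$. Switching network: $\mathcal{P}=\{1,\dots,m\}$ is an index set ($m$ may be infinite) and $\{\mathsf{A}_p\}_{p\in\mathcal{P}}$ are adjacency matrices whose nonzero entries all lie in a fixed interval $[\underline a,\bar a]$ with $0<\underline a\le\bar a$. A switching signal $\sigma:[0,\infty)\to\mathcal{P}$ is piecewise constant (finitely many discontinuities in each bounded interval), right-continuous, with switching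 times (discontinuities) $t_0=0,t_1,t_2,\dots$. For $t_1<t_2$, the joint digraph $\cup_{t_1}^{t_2}\mathcal{G}(t)$ is the digraph whose edge set is the union of the edge sets of $\mathcal{G}(t)$, $t\in[t_1,t_2)$. Admissible switching set $\mathcal{S}_{\mathrm{admis}}$: a set of piecewise constant switching signals $\sigma:[0,\infty)\to\mathcal{P}$ with some dwell time $t_L$ (i.e. $t_{k+1}-t_k>t_L>0$ for all $k=0,1,\dots$) such that: (i) $\Gamma(\mathsf{A}_{\sigma(t)})$ is weight-balanced for all $t\ge t_0$; (ii) the number of contiguous, nonempty, uniformly bounded time intervals $[t_{i_j},t_{i_{j+1}})$, $j=1,2,\dots$, starting at $t_{i_1}=t_0$, with the property that $\cup_{t_{i_j}}^{t_{i_{j+1}}}\Gamma(\mathsf{A}_{\sigma(t)})$ is strongly connected, goes to infinity as $t\to\infty$. "Exponentially fast" means that the deviation from the limit is bounded by $\kappa e^{-\chi t}$, $t\ge 0$, for some constants $\kappa,\chi>0$. Solutions are continuous and satisfy the equations away from switching times. *)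

theory Defs
  imports
    "HOL-Analysis.Analysis"
    "HOL-Library.Extended_Nat"
    "Graph_Theory.Graph_Theory"
begin

text \<open>
  The node set is the finite type \<open>'n\<close>, with \<open>N = CARD('n)\<close>. A weighted digraph is carried by
  its adjacency matrix; its underlying digraph, without the weights, is a \<open>pair_pre_digraph\<close>.
\<close>

definition digraph_of :: "real^'n^'n \<Rightarrow> 'n pair_pre_digraph" where
  "digraph_of A = \<lparr> pverts = UNIV, parcs = {(i, j). A $ i $ j > 0} \<rparr>"

definition weight_balanced :: "real^'n^'n \<Rightarrow> bool" where
  "weight_balanced A \<longleftrightarrow> (\<forall>i. (\<Sum>j\<in>UNIV. A $ i $ j) = (\<Sum>j\<in>UNIV. A $ j $ i))"

definition out_degree_matrix :: "real^'n^'n \<Rightarrow> real^'n^'n" where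
  "out_degree_matrix A = (\<chi> i j. if i = j then \<Sum>k\<in>UNIV. A $ i $ k else 0)"

definition laplacian :: "real^'n^'n \<Rightarrow> real^'n^'n" where
  "laplacian A = out_degree_matrix A - A"

definition index_set :: "enat \<Rightarrow> nat set" where
  "index_set m = {p. 1 \<le> p \<and> enat p \<le> m}"

definition adjacency_family ::
  "nat set \<Rightarrow> real \<Rightarrow> real \<Rightarrow> (nat \<Rightarrow> real^'n^'n) \<Rightarrow> bool" where
  "adjacency_family P lo hi A \<longleftrightarrow>
     (\<forall>p\<in>P. \<forall>i j. A p $ i $ j \<ge> 0 \<and> (A p $ i $ j \<noteq> 0 \<longrightarrow> A p $ i $ j \<in> {lo..hi}))"

text \<open>
  Signals are total functions on the reals of which only the restriction to \<open>{0..}\<close> matters.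
  Their values are natural numbers, whose topology is discrete, so a signal is constant on every
  subinterval of \<open>{0..}\<close> that contains no discontinuity.
\<close>

definition discontinuities :: "(real \<Rightarrow> nat) \<Rightarrow> real set" where
  "discontinuities \<sigma> = {t. 0 \<le> t \<and> \<not> continuous (at t within {0..}) \<sigma>}"

definition switching_signal :: "nat set \<Rightarrow> (real \<Rightarrow> nat) \<Rightarrow> bool" where
  "switching_signal P \<sigma> \<longleftrightarrow>
     (\<forall>t\<ge>0. \<sigma> t \<in> P) \<and>
     (\<forall>a b. finite (discontinuities \<sigma> \<inter> {a..b})) \<and>
     (\<forall>t\<ge>0. continuous (at_right t) \<sigma>)"

text \<open>The initial time \<open>t\<^sub>0 = 0\<close> counts as a switching time although \<open>\<sigma>\<close> does not jump there.\<close>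

definition switching_times :: "(real \<Rightarrow> nat) \<Rightarrow> real set" where
  "switching_times \<sigma> = insert 0 (discontinuities \<sigma>)"

text \<open>
  Since the inequality is strict, requiring it for all pairs of switching times is the same as
  requiring it for consecutive ones.
\<close>

definition has_dwell_time :: "real \<Rightarrow> (real \<Rightarrow> nat) \<Rightarrow> bool" where
  "has_dwell_time tL \<sigma> \<longleftrightarrow>
     (\<forall>s\<in>switching_times \<sigma>. \<forall>t\<in>switching_times \<sigma>. s < t \<longrightarrow> t - s > tL)"

definition joint_digraph ::
  "(nat \<Rightarrow> real^'n^'n) \<Rightarrow> (real \<Rightarrow> nat) \<Rightarrow> real \<Rightarrow> real \<Rightarrow> 'n pair_pre_digraph" where
  "joint_digraph A \<sigma> t1 t2 =
     \<lparr> pverts = UNIV, parcs = (\<Union>t\<in>{t1..<t2}. parcs (digraph_of (A (\<sigma> t)))) \<rparr>"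

text \<open>
  The sequence \<open>\<tau>\<close> lists the switching times that delimit the contiguous intervals
  \<open>{\<tau> j..<\<tau> (Suc j)}\<close>, and the cardinality below counts those completed by time \<open>t\<close>.
\<close>

definition recurrently_jointly_connected ::
  "(nat \<Rightarrow> real^'n^'n) \<Rightarrow> (real \<Rightarrow> nat) \<Rightarrow> bool" where
  "recurrently_jointly_connected A \<sigma> \<longleftrightarrow>
     (\<exists>\<tau>::nat \<Rightarrow> real.
        \<tau> 0 = 0 \<and>
        (\<forall>j. \<tau> j \<in> switching_times \<sigma>) \<and>
        (\<forall>j. \<tau> j < \<tau> (Suc j)) \<and>
        (\<exists>T. \<forall>j. \<tau> (Suc j) - \<tau> j \<le> T) \<and>
        (\<forall>j. strongly_connected (with_proj (joint_digraph A \<sigma> (\<tau> j) (\<tau> (Suc j))))) \<and>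
        filterlim (\<lambda>t. card {j. \<tau> (Suc j) \<le> t}) at_top at_top)"

definition admissible_switching_set ::
  "nat set \<Rightarrow> (nat \<Rightarrow> real^'n^'n) \<Rightarrow> (real \<Rightarrow> nat) set \<Rightarrow> bool" where
  "admissible_switching_set P A S \<longleftrightarrow>
     (\<exists>tL>0. \<forall>\<sigma>\<in>S.
        switching_signal P \<sigma> \<and>
        has_dwell_time tL \<sigma> \<and>
        (\<forall>t\<ge>0. weight_balanced (A (\<sigma> t))) \<and>
        recurrently_jointly_connected A \<sigma>)"

definition tends_exponentially_fast :: "(real \<Rightarrow> real) \<Rightarrow> real \<Rightarrow> bool" where
  "tends_exponentially_fast f l \<longleftrightarrow>
     (f \<longlongrightarrow> l) at_top \<and>
     (\<exists>\<kappa>>0. \<exists>c>0. \<forall>t\<ge>0. \<bar>f t - l\<bar> \<le> \<kappa> * exp (- c * t))"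

definition is_trajectory ::
  "real \<Rightarrow> real \<Rightarrow> (nat \<Rightarrow> real^'n^'n) \<Rightarrow> (real \<Rightarrow> nat) \<Rightarrow>
     (real \<Rightarrow> real^'n) \<Rightarrow> (real \<Rightarrow> real^'n) \<Rightarrow> bool" where
  "is_trajectory \<alpha> \<beta> A \<sigma> y w \<longleftrightarrow>
     continuous_on {0..} y \<and> continuous_on {0..} w \<and>
     (\<forall>t\<ge>0. t \<notin> switching_times \<sigma> \<longrightarrow>
        (y has_vector_derivative
           (- (\<alpha> *\<^sub>R y t) - \<beta> *\<^sub>R (laplacian (A (\<sigma> t)) *v y t) - w t)) (at t) \<and>
        (w has_vector_derivative
           ((\<alpha> * \<beta>) *\<^sub>R (laplacian (A (\<sigma> t)) *v y t))) (at t))"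

end

theory Submission
  imports Defs
begin

text \<open>
  Put \<open>z = \<alpha> y + w\<close>. The two Laplacian terms cancel in its derivative, so \<open>z' = - \<alpha> z\<close>, and the
  remaining equation becomes a consensus flow with a fading input, \<open>w' = - \<beta> L w + \<beta> L z\<close>. Since
  every digraph is weight-balanced, the mean \<open>w\<^sub>*\<close> of \<open>w\<close> is conserved. What must be shown is that \<open>w\<close>
  converges exponentially to the vector with all entries \<open>w\<^sub>*\<close>; then \<open>y = (z - w) / \<alpha>\<close> follows.

  The energy \<open>W = |w - w\<^sub>* 1|\<^sup>2 + K |z|\<^sup>2\<close>, with \<open>K\<close> large enough to absorb the input, satisfies
  \<open>W' \<le> - c G\<close> with \<open>G = (\<Sum>i j. a\<^sub>i\<^sub>j (w\<^sub>i - w\<^sub>j)\<^sup>2) + |z|\<^sup>2\<close>. At a single instant \<open>G\<close> may be small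
  although \<open>W\<close> is large, because the digraph need not be connected. But \<open>G\<close> also controls the speed:
  \<open>(w\<^sub>i')\<^sup>2 \<le> M G\<close>. Hence, by a Cauchy--Schwarz argument (\<open>drift_bound\<close>), if \<open>W\<close> drops by only \<open>\<delta>\<close>
  over a window of length at most \<open>T\<close>, no component moves by more than a multiple of \<open>sqrt \<delta>\<close> there.
  An edge of the joint digraph is present during a whole interval of dwell length inside the window,
  so at some moment of it \<open>(w\<^sub>i - w\<^sub>j)\<^sup>2\<close> is at most a multiple of \<open>\<delta>\<close>, and by slowness the same is
  true at the beginning of the window. Chaining along walks of the strongly connected joint digraph
  bounds all differences, so that \<open>W \<le> \<kappa> \<delta>\<close> at the beginning (\<open>window_contraction\<close>), with \<open>\<kappa>\<close> the
  same for all windows. Each window thus shrinks the monotone quantity \<open>W\<close> by a fixed factor, and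
  as the windows have bounded length the decay is exponential in time.

  The adjacency matrices enter the constants only through the bounds on their weights, which is why
  there may be infinitely many of them.
\<close>

section \<open>Drift bounds and exponential decay\<close>

lemma nonincreasing_except_finite:
  fixes h h' :: "real \<Rightarrow> real"
  assumes ab: "a \<le> b" and X: "finite X" and cont: "continuous_on {a..b} h"
    and deriv: "\<And>t. t \<in> {a<..<b} - X \<Longrightarrow> (h has_real_derivative h' t) (at t)"
    and nonpos: "\<And>t. t \<in> {a<..<b} - X \<Longrightarrow> h' t \<le> 0"
  shows "h b \<le> h a"
proof -
  define g where "g t = (if t \<in> {a<..<b} - X then h' t else 0)" for t
  have "(g has_integral (h b - h a)) {a..b}"
    by (rule fundamental_theorem_of_calculus_interior_strong[OF X ab _ cont])
      (use deriv in \<open>auto simp: g_def has_real_derivative_iff_has_vector_derivative\<close>)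
  then have "h b - h a \<le> 0"
    by (rule has_integral_le[OF _ has_integral_0]) (use nonpos in \<open>auto simp: g_def\<close>)
  then show ?thesis by simp
qed

text \<open>
  If \<open>f\<close> can only move fast at the expense of \<open>W\<close>, then a small drop of \<open>W\<close> forces a small
  displacement of \<open>f\<close>. This is \<open>(\<integral> f')\<^sup>2 \<le> (b - a) \<integral> (f')\<^sup>2\<close>, obtained without integrability of
  \<open>(f')\<^sup>2\<close> from monotonicity of a suitable linear combination.
\<close>
lemma drift_bound:
  fixes f f' W W' :: "real \<Rightarrow> real"
  assumes ab: "a \<le> b" and X: "finite X"
    and cont: "continuous_on {a..b} f" "continuous_on {a..b} W"
    and df: "\<And>t. t \<in> {a<..<b} - X \<Longrightarrow> (f has_real_derivative f' t) (at t)"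
    and dW: "\<And>t. t \<in> {a<..<b} - X \<Longrightarrow> (W has_real_derivative W' t) (at t)"
    and speed: "\<And>t. t \<in> {a<..<b} - X \<Longrightarrow> (f' t)\<^sup>2 \<le> - C * W' t"
  shows "(f b - f a)\<^sup>2 \<le> C * (b - a) * (W a - W b)"
proof (cases "a = b")
  case False
  with ab have len: "b - a > 0" by simp
  \<comment> \<open>For every real \<open>c\<close> the derivative of \<open>h\<close> is at most \<open>- (f' - c)\<^sup>2\<close>; the mean slope is the
    value of \<open>c\<close> that makes the resulting inequality strongest.\<close>
  define c where "c = (f b - f a) / (b - a)"
  define h where "h t = 2 * c * f t - c\<^sup>2 * t + C * W t" for t
  have "h b \<le> h a"
  proof (rule nonincreasing_except_finite[OF ab X])
    show "continuous_on {a..b} h"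
      unfolding h_def by (intro continuous_intros cont)
    fix t assume t: "t \<in> {a<..<b} - X"
    show "(h has_real_derivative (2 * c * f' t - c\<^sup>2 + C * W' t)) (at t)"
      unfolding h_def by (auto intro!: derivative_eq_intros df[OF t] dW[OF t])
    have "2 * c * f' t - c\<^sup>2 + C * W' t \<le> - (f' t - c)\<^sup>2"
      using speed[OF t] by (simp add: power2_eq_square algebra_simps)
    then show "2 * c * f' t - c\<^sup>2 + C * W' t \<le> 0"
      by (smt (verit) zero_le_power2)
  qed
  then have "2 * c * (f b - f a) - c\<^sup>2 * (b - a) \<le> C * (W a - W b)"
    unfolding h_def by (simp add: algebra_simps)
  moreover have "2 * c * (f b - f a) - c\<^sup>2 * (b - a) = (f b - f a)\<^sup>2 / (b - a)"
    using len by (simp add: c_def power2_eq_square)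
  ultimately have "(f b - f a)\<^sup>2 / (b - a) \<le> C * (W a - W b)" by simp
  then show ?thesis using len by (simp only: pos_divide_le_eq mult_ac)
qed simp

text \<open>
  At time \<open>t\<close> in the window that starts at \<open>\<tau> j\<close>, at least \<open>t / T - 1\<close> contractions have taken
  place; the missing one is the factor \<open>1 / \<rho>\<close>.
\<close>
lemma exponential_decay_from_windows:
  fixes W :: "real \<Rightarrow> real" and \<tau> :: "nat \<Rightarrow> real"
  assumes start: "\<tau> 0 = 0" and step: "\<And>j. \<tau> j < \<tau> (Suc j)" "\<And>j. \<tau> (Suc j) - \<tau> j \<le> T"
    and unbounded: "\<And>t. \<exists>j. t < \<tau> j"
    and \<rho>: "0 < \<rho>" "\<rho> < 1"
    and contract: "\<And>j. W (\<tau> (Suc j)) \<le> \<rho> * W (\<tau> j)"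
    and mono: "\<And>s t. 0 \<le> s \<Longrightarrow> s \<le> t \<Longrightarrow> W t \<le> W s"
    and W0: "0 \<le> W 0" and t: "0 \<le> t"
  shows "W t \<le> W 0 / \<rho> * exp (- (- ln \<rho> / T) * t)"
proof -
  have T: "0 < T" using step[of 0] by linarith
  define n where "n = (LEAST j. t < \<tau> j)"
  have n: "t < \<tau> n" unfolding n_def by (rule LeastI_ex[OF unbounded])
  with t start obtain j where j: "n = Suc j" by (cases n) auto
  have "\<not> t < \<tau> j" using not_less_Least[of j "\<lambda>j. t < \<tau> j"] j n_def by auto
  then have tj: "\<tau> j \<le> t" by simp
  have bounds: "0 \<le> \<tau> k \<and> \<tau> k \<le> k * T" for k
  proof (induction k)
    case (Suc k) then show ?case using step[of k] by (auto simp: algebra_simps)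
  qed (simp add: start)
  have geo: "W (\<tau> k) \<le> \<rho> ^ k * W 0" for k
  proof (induction k)
    case (Suc k)
    have "W (\<tau> (Suc k)) \<le> \<rho> * W (\<tau> k)" by (rule contract)
    also have "\<dots> \<le> \<rho> * (\<rho> ^ k * W 0)" using Suc \<rho> by (intro mult_left_mono) auto
    finally show ?case by simp
  qed (simp add: start)
  have "t \<le> Suc j * T" using n bounds[of "Suc j"] unfolding j by linarith
  then have "t / T \<le> Suc j" using T by (simp add: pos_divide_le_eq)
  then have "ln \<rho> * Suc j \<le> ln \<rho> * (t / T)"
    using \<rho> by (intro mult_left_mono_neg) auto
  then have "exp (ln \<rho> * Suc j) \<le> exp (ln \<rho> * (t / T))" by simp
  moreover have "exp (ln \<rho> * Suc j) = \<rho> ^ Suc j"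
    using \<rho> by (metis exp_ln exp_of_nat2_mult)
  moreover have "ln \<rho> * (t / T) = - (- ln \<rho> / T) * t" by simp
  ultimately have "\<rho> ^ Suc j \<le> exp (- (- ln \<rho> / T) * t)" by metis
  then have "\<rho> ^ j \<le> exp (- (- ln \<rho> / T) * t) / \<rho>"
    using \<rho> by (simp add: pos_le_divide_eq mult.commute)
  then have "\<rho> ^ j * W 0 \<le> exp (- (- ln \<rho> / T) * t) / \<rho> * W 0"
    using W0 by (rule mult_right_mono)
  moreover have "W t \<le> \<rho> ^ j * W 0"
    using mono[of "\<tau> j" t] bounds tj geo[of j] by force
  ultimately show ?thesis by (simp add: mult.commute)
qed

lemma tends_exponentially_fast_squareI:
  assumes c: "0 < c" and bound: "\<And>t. 0 \<le> t \<Longrightarrow> (f t - l)\<^sup>2 \<le> C * exp (- c * t)"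
  shows "tends_exponentially_fast f l"
proof -
  have "0 \<le> C" using bound[of 0] by (smt (verit) exp_zero mult_cancel_left1 mult_zero_right zero_le_power2)
  \<comment> \<open>The summand one makes the factor positive when \<open>C = 0\<close>.\<close>
  have ineq: "\<bar>f t - l\<bar> \<le> (sqrt C + 1) * exp (- (c / 2) * t)" if "0 \<le> t" for t
  proof -
    have "\<bar>f t - l\<bar> \<le> sqrt (C * exp (- c * t))"
      using real_sqrt_le_mono[OF bound[OF that]] by simp
    also have "exp (- c * t) = (exp (- (c / 2) * t))\<^sup>2"
      by (simp add: power2_eq_square flip: exp_add)
    also have "sqrt (C * (exp (- (c / 2) * t))\<^sup>2) = sqrt C * exp (- (c / 2) * t)"
      by (simp add: real_sqrt_mult)
    also have "\<dots> \<le> (sqrt C + 1) * exp (- (c / 2) * t)" by (simp add: algebra_simps)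
    finally show ?thesis .
  qed
  have "filterlim (\<lambda>t. - (c / 2) * t) at_bot at_top"
    using c by (intro filterlim_tendsto_neg_mult_at_bot[OF tendsto_const _ filterlim_ident]) auto
  then have "((\<lambda>t. exp (- (c / 2) * t)) \<longlongrightarrow> 0) at_top"
    by (rule filterlim_compose[OF exp_at_bot])
  then have lim0: "((\<lambda>t. (sqrt C + 1) * exp (- (c / 2) * t)) \<longlongrightarrow> 0) at_top"
    by (rule tendsto_mult_right_zero)
  have "((\<lambda>t. f t - l) \<longlongrightarrow> 0) at_top"
    by (rule Lim_null_comparison[OF _ lim0])
      (use ineq in \<open>auto intro: eventually_at_top_linorderI[of 0]\<close>)
  then have "(f \<longlongrightarrow> l) at_top" by (simp add: LIM_zero_iff)
  moreover have "0 < sqrt C + 1" using \<open>0 \<le> C\<close> by (simp add: add_nonneg_pos)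
  ultimately show ?thesis
    unfolding tends_exponentially_fast_def using ineq c
    by (intro conjI exI[of _ "sqrt C + 1"] exI[of _ "c / 2"]) auto
qed

section \<open>Propagation of bounds along a strongly connected digraph\<close>

text \<open>
  The number of arcs bounds the length of a shortest walk; only the uniformity of the factor
  matters, so this crude bound is enough.
\<close>
lemma strongly_connected_spread_bound:
  fixes x :: "'n::finite \<Rightarrow> real" and G :: "'n pair_pre_digraph"
  assumes sc: "strongly_connected (with_proj G)" and verts: "pverts G = UNIV"
    and arc: "\<And>i j. (i, j) \<in> parcs G \<Longrightarrow> \<bar>x i - x j\<bar> \<le> d" and d: "0 \<le> d"
  shows "\<bar>x i - x j\<bar> \<le> real CARD('n \<times> 'n) * d"
proof -
  have walk: "(u, v) \<in> parcs G ^^ k \<Longrightarrow> \<bar>x u - x v\<bar> \<le> k * d" for u v k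
  proof (induction k arbitrary: v)
    case (Suc k)
    then obtain v' where "(u, v') \<in> parcs G ^^ k" "(v', v) \<in> parcs G" by auto
    with Suc.IH[of v'] arc[of v' v] have "\<bar>x u - x v'\<bar> \<le> k * d" "\<bar>x v' - x v\<bar> \<le> d" by auto
    then show ?case by (simp add: algebra_simps)
  qed auto
  have "i \<rightarrow>\<^sup>*\<^bsub>with_proj G\<^esub> j" using sc verts by (auto simp: strongly_connected_def)
  then have "(i, j) \<in> (parcs G)\<^sup>*"
    by (auto dest: reachable_rtranclI)
  then obtain k where k: "k \<le> card (parcs G)" "(i, j) \<in> parcs G ^^ k"
    by (auto simp: rtrancl_finite_eq_relpow)
  have "card (parcs G) \<le> CARD('n \<times> 'n)" by (rule card_mono) auto
  with k(1) have "k \<le> CARD('n \<times> 'n)" by (rule order_trans)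
  then have "real k * d \<le> real CARD('n \<times> 'n) * d"
    using d by (intro mult_right_mono of_nat_mono)
  with walk[OF k(2)] show ?thesis by simp
qed

section \<open>Laplacians of weight-balanced digraphs\<close>

definition disagreement :: "real^'n^'n \<Rightarrow> real^'n \<Rightarrow> real" where
  "disagreement A x = (\<Sum>i\<in>UNIV. \<Sum>j\<in>UNIV. A $ i $ j * (x $ i - x $ j)\<^sup>2)"

lemma laplacian_component:
  "(laplacian A *v x) $ i = (\<Sum>j\<in>UNIV. A $ i $ j * (x $ i - x $ j))"
proof -
  have "(laplacian A *v x) $ i
      = (\<Sum>j\<in>UNIV. (if i = j then (\<Sum>k\<in>UNIV. A $ i $ k) * x $ j else 0) - A $ i $ j * x $ j)"
    by (auto simp: laplacian_def out_degree_matrix_def matrix_vector_mult_def algebra_simps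
        intro!: sum.cong)
  also have "\<dots> = (\<Sum>k\<in>UNIV. A $ i $ k) * x $ i - (\<Sum>j\<in>UNIV. A $ i $ j * x $ j)"
    by (simp add: sum_subtractf)
  also have "\<dots> = (\<Sum>j\<in>UNIV. A $ i $ j * (x $ i - x $ j))"
    by (simp add: sum_subtractf sum_distrib_right right_diff_distrib)
  finally show ?thesis .
qed

text \<open>
  Weight balance in the form in which it is used throughout: in a sum over the edges, a function of
  the head may be replaced by the same function of the tail.
\<close>
lemma weight_balanced_sum:
  assumes "weight_balanced A"
  shows "(\<Sum>i\<in>UNIV. \<Sum>j\<in>UNIV. A $ i $ j * f j) = (\<Sum>i\<in>UNIV. \<Sum>j\<in>UNIV. A $ i $ j * f i)"
proof -
  have "(\<Sum>i\<in>UNIV. \<Sum>j\<in>UNIV. A $ i $ j * f j) = (\<Sum>j\<in>UNIV. (\<Sum>i\<in>UNIV. A $ i $ j) * f j)"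
    by (subst sum.swap) (simp add: sum_distrib_right)
  also have "\<dots> = (\<Sum>j\<in>UNIV. (\<Sum>i\<in>UNIV. A $ j $ i) * f j)"
    using assms by (simp add: weight_balanced_def)
  finally show ?thesis by (simp add: sum_distrib_right)
qed

lemma weight_balanced_laplacian_sum:
  assumes "weight_balanced A"
  shows "(\<Sum>i\<in>UNIV. (laplacian A *v x) $ i) = 0"
  using weight_balanced_sum[OF assms, of "\<lambda>i. x $ i"]
  by (simp add: laplacian_component sum_subtractf algebra_simps)

lemma weight_balanced_inner_laplacian:
  assumes "weight_balanced A"
  shows "x \<bullet> (laplacian A *v z)
      = (\<Sum>i\<in>UNIV. \<Sum>j\<in>UNIV. A $ i $ j * ((x $ j - x $ i) * z $ j))"
  using weight_balanced_sum[OF assms, of "\<lambda>i. x $ i * z $ i"]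
  by (simp add: inner_vec_def laplacian_component sum_subtractf sum_distrib_left algebra_simps)

lemma weight_balanced_inner_laplacian_self:
  assumes "weight_balanced A"
  shows "x \<bullet> (laplacian A *v x) = disagreement A x / 2"
proof -
  let ?S = "\<lambda>f. \<Sum>i\<in>UNIV. \<Sum>j\<in>UNIV. A $ i $ j * f i j"
  have "x \<bullet> (laplacian A *v x) = ?S (\<lambda>i j. (x $ j)\<^sup>2 - x $ i * x $ j)"
    by (simp add: weight_balanced_inner_laplacian[OF assms] power2_eq_square left_diff_distrib)
  also have "\<dots> = ?S (\<lambda>i j. (x $ j)\<^sup>2) - ?S (\<lambda>i j. x $ i * x $ j)"
    by (simp only: right_diff_distrib sum_subtractf)
  finally have inner: "x \<bullet> (laplacian A *v x) = \<dots>" .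
  have "disagreement A x = ?S (\<lambda>i j. (x $ i)\<^sup>2 + (x $ j)\<^sup>2 - 2 * (x $ i * x $ j))"
    by (simp add: disagreement_def power2_diff mult.assoc)
  also have "\<dots> = ?S (\<lambda>i j. (x $ i)\<^sup>2) + ?S (\<lambda>i j. (x $ j)\<^sup>2) - 2 * ?S (\<lambda>i j. x $ i * x $ j)"
    by (simp only: right_diff_distrib distrib_left sum_subtractf sum.distrib sum_distrib_left
        mult.left_commute[of _ 2])
  finally show ?thesis
    using inner weight_balanced_sum[OF assms, of "\<lambda>i. (x $ i)\<^sup>2"] by simp
qed

lemma component_square_le_inner:
  fixes x :: "real^'n"
  shows "(x $ i)\<^sup>2 \<le> x \<bullet> x"
  unfolding inner_vec_def using member_le_sum[of i UNIV "\<lambda>i. (x $ i)\<^sup>2"]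
  by (simp add: power2_eq_square)

lemma inner_self_le:
  fixes x :: "real^'n" and b :: real
  assumes "\<And>i. (x $ i)\<^sup>2 \<le> b"
  shows "x \<bullet> x \<le> CARD('n) * b"
  unfolding inner_vec_def using sum_bounded_above[of UNIV "\<lambda>i. x $ i * x $ i" b] assms
  by (simp add: power2_eq_square)

lemma sum_rows_le:
  fixes A :: "real^'n^'n" and h :: real
  assumes "\<And>i j. 0 \<le> A $ i $ j" "\<And>i j. A $ i $ j \<le> h"
  shows "(\<Sum>i\<in>UNIV. \<Sum>j\<in>UNIV. A $ i $ j * (x $ i)\<^sup>2) \<le> CARD('n) * h * (x \<bullet> x)"
proof -
  have "(\<Sum>j\<in>UNIV. A $ i $ j * (x $ i)\<^sup>2) \<le> CARD('n) * h * (x $ i)\<^sup>2" for i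
    using assms sum_bounded_above[of UNIV "\<lambda>j. A $ i $ j * (x $ i)\<^sup>2" "h * (x $ i)\<^sup>2"]
    by (simp add: mult_right_mono mult.assoc)
  then have "(\<Sum>i\<in>UNIV. \<Sum>j\<in>UNIV. A $ i $ j * (x $ i)\<^sup>2) \<le> (\<Sum>i\<in>UNIV. CARD('n) * h * (x $ i)\<^sup>2)"
    by (rule sum_mono)
  then show ?thesis by (simp add: inner_vec_def sum_distrib_left power2_eq_square)
qed

text \<open>
  The input \<open>L z\<close> acts on \<open>x\<close> only through the differences of \<open>x\<close> along edges, so it costs a quarter
  of the disagreement, which is half of what \<open>x \<bullet> L x\<close> provides.
\<close>
lemma inner_laplacian_le:
  fixes A :: "real^'n^'n" and h :: real
  assumes nonneg: "\<And>i j. 0 \<le> A $ i $ j" and le: "\<And>i j. A $ i $ j \<le> h"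
    and bal: "weight_balanced A"
  shows "x \<bullet> (laplacian A *v z) \<le> disagreement A x / 4 + CARD('n) * h * (z \<bullet> z)"
proof -
  have young: "a * b \<le> a\<^sup>2 / 4 + b\<^sup>2" for a b :: real
    using zero_le_power2[of "a / 2 - b"] by (simp add: power2_eq_square algebra_simps)
  have "x \<bullet> (laplacian A *v z)
      \<le> (\<Sum>i\<in>UNIV. \<Sum>j\<in>UNIV. A $ i $ j * ((x $ j - x $ i)\<^sup>2 / 4 + (z $ j)\<^sup>2))"
    unfolding weight_balanced_inner_laplacian[OF bal]
    by (intro sum_mono mult_left_mono young nonneg)
  also have "\<dots> = disagreement A x / 4 + (\<Sum>i\<in>UNIV. \<Sum>j\<in>UNIV. A $ i $ j * (z $ j)\<^sup>2)"
    by (simp add: disagreement_def sum.distrib distrib_left sum_divide_distrib power2_commute)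
  also have "\<dots> \<le> disagreement A x / 4 + CARD('n) * h * (z \<bullet> z)"
    using sum_rows_le[of A h z, OF nonneg le] weight_balanced_sum[OF bal, of "\<lambda>i. (z $ i)\<^sup>2"] by simp
  finally show ?thesis .
qed

lemma disagreement_le:
  fixes A :: "real^'n^'n" and h :: real
  assumes nonneg: "\<And>i j. 0 \<le> A $ i $ j" and le: "\<And>i j. A $ i $ j \<le> h"
    and bal: "weight_balanced A"
  shows "disagreement A x \<le> 4 * (CARD('n) * h) * (x \<bullet> x)"
proof -
  have sq: "(a - b)\<^sup>2 \<le> 2 * a\<^sup>2 + 2 * b\<^sup>2" for a b :: real
    using zero_le_power2[of "a + b"] by (simp add: power2_eq_square algebra_simps)
  have "disagreement A x
      \<le> (\<Sum>i\<in>UNIV. \<Sum>j\<in>UNIV. A $ i $ j * (2 * (x $ i)\<^sup>2 + 2 * (x $ j)\<^sup>2))"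
    unfolding disagreement_def by (intro sum_mono mult_left_mono sq nonneg)
  also have "\<dots> = 2 * (\<Sum>i\<in>UNIV. \<Sum>j\<in>UNIV. A $ i $ j * (x $ i)\<^sup>2)
                + 2 * (\<Sum>i\<in>UNIV. \<Sum>j\<in>UNIV. A $ i $ j * (x $ j)\<^sup>2)"
    by (simp add: sum.distrib sum_distrib_left algebra_simps)
  also have "\<dots> = 4 * (\<Sum>i\<in>UNIV. \<Sum>j\<in>UNIV. A $ i $ j * (x $ i)\<^sup>2)"
    using weight_balanced_sum[OF bal, of "\<lambda>i. (x $ i)\<^sup>2"] by simp
  finally show ?thesis using sum_rows_le[of A h x, OF nonneg le] by simp
qed

lemma disagreement_diff_le:
  assumes "\<And>i j. 0 \<le> A $ i $ j"
  shows "disagreement A (x - z) \<le> 2 * disagreement A x + 2 * disagreement A z"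
proof -
  have sq: "(a - b - (c - d))\<^sup>2 \<le> 2 * (a - c)\<^sup>2 + 2 * (b - d)\<^sup>2" for a b c d :: real
    using zero_le_power2[of "a - c + (b - d)"] by (simp add: power2_eq_square algebra_simps)
  have "disagreement A (x - z)
      \<le> (\<Sum>i\<in>UNIV. \<Sum>j\<in>UNIV. A $ i $ j * (2 * (x $ i - x $ j)\<^sup>2 + 2 * (z $ i - z $ j)\<^sup>2))"
    unfolding disagreement_def by (intro sum_mono mult_left_mono) (auto intro: assms sq)
  then show ?thesis
    by (simp add: disagreement_def sum.distrib sum_distrib_left algebra_simps)
qed

lemma disagreement_nonneg: "(\<And>i j. 0 \<le> A $ i $ j) \<Longrightarrow> 0 \<le> disagreement A x"
  unfolding disagreement_def by (intro sum_nonneg mult_nonneg_nonneg) auto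

lemma edge_le_disagreement:
  assumes "\<And>i j. 0 \<le> A $ i $ j"
  shows "A $ i $ j * (x $ i - x $ j)\<^sup>2 \<le> disagreement A x"
proof -
  have "A $ i $ j * (x $ i - x $ j)\<^sup>2 \<le> (\<Sum>j\<in>UNIV. A $ i $ j * (x $ i - x $ j)\<^sup>2)"
    using assms by (intro member_le_sum[of j]) auto
  also have "\<dots> \<le> disagreement A x"
    unfolding disagreement_def using assms
    by (intro member_le_sum[of i "UNIV" "\<lambda>i. \<Sum>j\<in>UNIV. A $ i $ j * (x $ i - x $ j)\<^sup>2"])
      (auto intro!: sum_nonneg)
  finally show ?thesis .
qed

lemma laplacian_component_le_disagreement:
  fixes A :: "real^'n^'n" and h :: real
  assumes nonneg: "\<And>i j. 0 \<le> A $ i $ j" and le: "\<And>i j. A $ i $ j \<le> h"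
  shows "((laplacian A *v x) $ i)\<^sup>2 \<le> CARD('n) * h * disagreement A x"
proof -
  let ?S = "\<Sum>j\<in>UNIV. A $ i $ j * (x $ i - x $ j)\<^sup>2"
  have "((laplacian A *v x) $ i)\<^sup>2
      = (\<Sum>j\<in>UNIV. sqrt (A $ i $ j) * (sqrt (A $ i $ j) * (x $ i - x $ j)))\<^sup>2"
    using nonneg by (simp add: laplacian_component flip: mult.assoc)
  also have "\<dots> \<le> (\<Sum>j\<in>UNIV. (sqrt (A $ i $ j))\<^sup>2) * (\<Sum>j\<in>UNIV. (sqrt (A $ i $ j) * (x $ i - x $ j))\<^sup>2)"
    by (rule Cauchy_Schwarz_ineq_sum)
  also have "\<dots> = (\<Sum>j\<in>UNIV. A $ i $ j) * ?S"
    using nonneg by (simp add: power_mult_distrib)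
  also have "\<dots> \<le> (CARD('n) * h) * ?S"
    using le sum_bounded_above[of UNIV "\<lambda>j. A $ i $ j" h] nonneg
    by (intro mult_right_mono sum_nonneg) auto
  also have "\<dots> \<le> (CARD('n) * h) * disagreement A x"
  proof (rule mult_left_mono)
    show "?S \<le> disagreement A x"
      unfolding disagreement_def using nonneg
      by (intro member_le_sum[of i "UNIV" "\<lambda>i. \<Sum>j\<in>UNIV. A $ i $ j * (x $ i - x $ j)\<^sup>2"])
        (auto intro!: sum_nonneg)
    have "0 \<le> h" using nonneg le order_trans by blast
    then show "0 \<le> CARD('n) * h" by simp
  qed
  finally show ?thesis .
qed

section \<open>Switching signals with a dwell time\<close>

lemma signal_constant_between_switches:
  assumes sig: "switching_signal P \<sigma>" and p: "0 \<le> p"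
    and no_switch: "{p<..r} \<inter> switching_times \<sigma> = {}" and x: "x \<in> {p..r}"
  shows "\<sigma> x = \<sigma> p"
proof (cases "p < r")
  case True
  have "continuous_on {p..r} \<sigma>"
    unfolding continuous_on_eq_continuous_within
  proof
    fix s assume s: "s \<in> {p..r}"
    show "continuous (at s within {p..r}) \<sigma>"
    proof (cases "s = p")
      case True
      have "continuous (at_right p) \<sigma>" using sig p by (simp add: switching_signal_def)
      then show ?thesis
        using True \<open>p < r\<close> by (simp add: continuous_within at_within_Icc_at_right)
    next
      case False
      then have "s \<in> {p<..r}" using s by auto
      then have "s \<notin> discontinuities \<sigma>" using no_switch by (auto simp: switching_times_def)
      then have "continuous (at s within {0..}) \<sigma>"
        using s p by (auto simp: discontinuities_def)
      then show ?thesis by (rule continuous_within_subset) (use p in auto)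
    qed
  qed
  then have cont: "continuous_on {p..r} (\<lambda>s. real (\<sigma> s))"
    by (intro continuous_on_compose2[OF Topological_Spaces.continuous_on_discrete[of UNIV real]]) auto
  have "(\<lambda>s. real (\<sigma> s)) constant_on {p..r}"
  proof (rule continuous_discrete_range_constant[OF _ cont])
    show "\<exists>e>0. \<forall>u. u \<in> {p..r} \<and> real (\<sigma> u) \<noteq> real (\<sigma> s) \<longrightarrow> e \<le> norm (real (\<sigma> u) - real (\<sigma> s))" for s
      by (intro exI[of _ 1]) auto
  qed simp
  then obtain v where "\<And>u. u \<in> {p..r} \<Longrightarrow> real (\<sigma> u) = v" by (auto simp: constant_on_def)
  from this[OF x] this[of p] show ?thesis using True by simp
next
  case False
  then have "x = p" using x by auto
  then show ?thesis by simp
qed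

text \<open>
  The interval starts at the last switching time \<open>p\<close> up to \<open>t\<close>. It need not contain \<open>t\<close>, but the
  signal keeps its value from \<open>p\<close> until \<open>t\<close>. It lies inside the window because the end of the
  window is itself a switching time after \<open>p\<close>.
\<close>
lemma signal_value_persists:
  assumes sig: "switching_signal P \<sigma>" and dwell: "has_dwell_time tL \<sigma>" and tL: "0 < tL"
    and s: "s \<in> switching_times \<sigma>" and s': "s' \<in> switching_times \<sigma>" and t: "s \<le> t" "t < s'"
  obtains p where "s \<le> p" "p + tL < s'" "{p<..p + tL} \<inter> switching_times \<sigma> = {}"
    "\<And>x. x \<in> {p..p + tL} \<Longrightarrow> \<sigma> x = \<sigma> t"
proof -
  have nonneg: "0 \<le> u" if "u \<in> switching_times \<sigma>" for u
    using that by (auto simp: switching_times_def discontinuities_def)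
  let ?F = "switching_times \<sigma> \<inter> {s..t}"
  have "?F \<subseteq> insert 0 (discontinuities \<sigma> \<inter> {s..t})" by (auto simp: switching_times_def)
  then have fin: "finite ?F"
    using sig by (auto simp: switching_signal_def intro: finite_subset)
  have ne: "s \<in> ?F" using s t by auto
  define p where "p = Max ?F"
  have p: "p \<in> ?F" unfolding p_def using fin ne by (intro Max_in) auto
  have gap: "u > p + tL" if "u \<in> switching_times \<sigma>" "u > p" for u
    using dwell p that by (force simp: has_dwell_time_def)
  \<comment> \<open>\<open>t\<close> may lie before or after \<open>p + tL\<close>, so both stretches are treated at once.\<close>
  have none: "{p<..max t (p + tL)} \<inter> switching_times \<sigma> = {}"
  proof safe
    fix u assume u: "u \<in> {p<..max t (p + tL)}" "u \<in> switching_times \<sigma>"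
    then have "p + tL < u" using gap by auto
    then have "u \<in> ?F" using u p by (auto simp: max_def split: if_splits)
    then have "u \<le> p" unfolding p_def using fin by (intro Max_ge) auto
    then show "u \<in> {}" using u by auto
  qed
  have const: "\<sigma> x = \<sigma> p" if "x \<in> {p..max t (p + tL)}" for x
    using signal_constant_between_switches[OF sig _ none that] nonneg p by auto
  show ?thesis
  proof (rule that[of p])
    show "p + tL < s'" using gap[OF s'] p t by auto
    show "{p<..p + tL} \<inter> switching_times \<sigma> = {}"
      using none by (auto simp: disjoint_iff)
    show "\<sigma> x = \<sigma> t" if "x \<in> {p..p + tL}" for x
      using const[of x] const[of t] that p by auto
  qed (use p in auto)
qed


section \<open>The energy and its dissipation\<close>

text \<open>
  The number of nodes is a parameter so that the constants below depend on a number instead of on the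
  type of the nodes.
\<close>
locale switched_consensus =
  fixes P :: "nat set" and A :: "nat \<Rightarrow> real^'n^'n" and \<sigma> :: "real \<Rightarrow> nat"
    and N lo hi tL \<alpha> \<beta> :: real and y w :: "real \<Rightarrow> real^'n"
  assumes N_eq: "real CARD('n) = N"
    and family: "adjacency_family P lo hi A" and lo: "0 < lo" and lo_le_hi: "lo \<le> hi"
    and signal: "switching_signal P \<sigma>" and dwell: "has_dwell_time tL \<sigma>" and tL: "0 < tL"
    and balanced: "\<And>t. 0 \<le> t \<Longrightarrow> weight_balanced (A (\<sigma> t))"
    and \<alpha>: "0 < \<alpha>" and \<beta>: "0 < \<beta>"
    and trajectory: "is_trajectory \<alpha> \<beta> A \<sigma> y w"
begin

abbreviation "L t \<equiv> laplacian (A (\<sigma> t))"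

definition z :: "real \<Rightarrow> real^'n" where "z t = \<alpha> *\<^sub>R y t + w t"
definition mean :: real where "mean = (\<Sum>j\<in>UNIV. w 0 $ j) / N"
text \<open>
  The weight makes \<open>\<alpha> K\<close> exceed by one the factor \<open>\<beta> N hi\<close> with which \<open>|z|\<^sup>2\<close> enters the estimate
  of the input.
\<close>
definition K :: real where "K = (\<beta> * (N * hi) + 1) / \<alpha>"
definition energy :: "real \<Rightarrow> real" where
  "energy t = (w t - vec mean) \<bullet> (w t - vec mean) + K * (z t \<bullet> z t)"
text \<open>This is \<open>\<alpha> \<beta> L y\<close> with \<open>y\<close> eliminated.\<close>
definition w_rate :: "real \<Rightarrow> real^'n" where "w_rate t = \<beta> *\<^sub>R (L t *v (z t - w t))"
definition energy_rate :: "real \<Rightarrow> real" where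
  "energy_rate t = 2 * ((w t - vec mean) \<bullet> w_rate t) - 2 * \<alpha> * K * (z t \<bullet> z t)"
definition dissipation :: "real \<Rightarrow> real" where
  "dissipation t = disagreement (A (\<sigma> t)) (w t) + z t \<bullet> z t"
definition c :: real where "c = min (\<beta> / 2) 2"
definition M :: real where "M = 2 * \<beta>\<^sup>2 * (N * hi) * (1 + 4 * (N * hi))"

lemma hi: "0 < hi" using lo lo_le_hi by simp

lemma N_pos: "0 < N" by (simp flip: N_eq)

lemma K_pos: "0 < K" and c_pos: "0 < c" and M_nonneg: "0 \<le> M"
  using \<alpha> \<beta> hi N_pos by (auto simp: K_def c_def M_def intro!: divide_pos_pos add_nonneg_pos)

lemma entries:
  assumes "0 \<le> t"
  shows "0 \<le> A (\<sigma> t) $ i $ j" and "A (\<sigma> t) $ i $ j \<le> hi"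
    and "0 < A (\<sigma> t) $ i $ j \<Longrightarrow> lo \<le> A (\<sigma> t) $ i $ j"
proof -
  have "\<sigma> t \<in> P" using signal assms by (simp add: switching_signal_def)
  then have "0 \<le> A (\<sigma> t) $ i $ j \<and> (A (\<sigma> t) $ i $ j \<noteq> 0 \<longrightarrow> A (\<sigma> t) $ i $ j \<in> {lo..hi})"
    using family by (simp add: adjacency_family_def)
  then show "0 \<le> A (\<sigma> t) $ i $ j" "A (\<sigma> t) $ i $ j \<le> hi"
    "0 < A (\<sigma> t) $ i $ j \<Longrightarrow> lo \<le> A (\<sigma> t) $ i $ j"
    using hi by (cases "A (\<sigma> t) $ i $ j = 0"; auto)+
qed

lemma switching_time_nonneg: "s \<in> switching_times \<sigma> \<Longrightarrow> 0 \<le> s"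
  by (auto simp: switching_times_def discontinuities_def)

lemma finite_switching_times: "finite (switching_times \<sigma> \<inter> {a..b})"
proof -
  have "finite (insert 0 (discontinuities \<sigma> \<inter> {a..b}))"
    using signal by (simp add: switching_signal_def)
  then show ?thesis by (rule finite_subset[rotated]) (auto simp: switching_times_def)
qed

lemma w_continuous: "continuous_on {0..} w" and z_continuous: "continuous_on {0..} z"
  using trajectory unfolding z_def[abs_def] is_trajectory_def
  by (auto intro!: continuous_intros)

lemma w_derivative:
  assumes "0 \<le> t" "t \<notin> switching_times \<sigma>"
  shows "(w has_vector_derivative w_rate t) (at t)"
proof -
  have "(\<alpha> * \<beta>) *\<^sub>R (L t *v y t) = w_rate t"
    by (simp add: w_rate_def z_def matrix_vector_mult_scaleR)
  moreover have "(w has_vector_derivative ((\<alpha> * \<beta>) *\<^sub>R (L t *v y t))) (at t)"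
    using trajectory assms by (simp add: is_trajectory_def)
  ultimately show ?thesis by simp
qed

lemma z_derivative:
  assumes "0 \<le> t" "t \<notin> switching_times \<sigma>"
  shows "(z has_vector_derivative - \<alpha> *\<^sub>R z t) (at t)"
proof -
  have "(z has_vector_derivative
      \<alpha> *\<^sub>R (- (\<alpha> *\<^sub>R y t) - \<beta> *\<^sub>R (L t *v y t) - w t) + (\<alpha> * \<beta>) *\<^sub>R (L t *v y t)) (at t)"
    unfolding z_def[abs_def] using trajectory assms
    by (intro has_vector_derivative_add
        bounded_linear.has_vector_derivative[OF bounded_linear_scaleR_right])
      (auto simp: is_trajectory_def)
  then show ?thesis by (simp add: z_def algebra_simps)
qed

text \<open>
  Constant vectors are orthogonal to the range of the Laplacian of a balanced digraph. This conserves
  the mean of \<open>w\<close>, and it removes the mean from the derivative of the energy.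
\<close>
lemma vec_inner_laplacian: "0 \<le> t \<Longrightarrow> vec a \<bullet> (L t *v x) = 0"
  using weight_balanced_laplacian_sum[OF balanced, of t x]
  by (simp add: inner_vec_def flip: sum_distrib_left)

lemma sum_w:
  assumes "0 \<le> t"
  shows "(\<Sum>j\<in>UNIV. w t $ j) = N * mean"
proof -
  have cont: "continuous_on {0..t} w" using w_continuous by (rule continuous_on_subset) auto
  have "((\<lambda>s. vec 1 \<bullet> w s) has_real_derivative 0) (at s)"
    if "s \<in> {0<..<t} - switching_times \<sigma> \<inter> {0..t}" for s
  proof -
    have s: "0 \<le> s" "s \<notin> switching_times \<sigma>" using that by auto
    show ?thesis
      using bounded_linear.has_vector_derivative[OF bounded_linear_inner_right w_derivative[OF s],
          of "vec 1"] vec_inner_laplacian[OF s(1), of 1]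
      by (simp add: has_real_derivative_iff_has_vector_derivative w_rate_def)
  qed
  note d = this DERIV_minus[OF this]
  have "vec 1 \<bullet> w t \<le> vec 1 \<bullet> w 0"
    by (rule nonincreasing_except_finite[OF assms finite_switching_times _ d(1)])
      (auto intro!: continuous_intros cont)
  moreover have "- (vec 1 \<bullet> w t) \<le> - (vec 1 \<bullet> w 0)"
    by (rule nonincreasing_except_finite[OF assms finite_switching_times _ d(2)])
      (auto intro!: continuous_intros cont)
  ultimately have "vec 1 \<bullet> w t = vec 1 \<bullet> w 0" by simp
  then show ?thesis using N_pos by (simp add: inner_vec_def mean_def)
qed

lemma energy_continuous: "0 \<le> a \<Longrightarrow> continuous_on {a..b} energy"
  unfolding energy_def[abs_def]
  by (intro continuous_intros continuous_on_subset[OF w_continuous]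
      continuous_on_subset[OF z_continuous]) auto

lemma energy_derivative:
  assumes "0 \<le> t" "t \<notin> switching_times \<sigma>"
  shows "(energy has_real_derivative energy_rate t) (at t)"
proof -
  have w: "((\<lambda>t. w t - vec mean) has_vector_derivative w_rate t) (at t)"
    using has_vector_derivative_diff[OF w_derivative[OF assms] has_vector_derivative_const] by simp
  note z = z_derivative[OF assms]
  show ?thesis
    unfolding energy_def[abs_def] has_real_derivative_iff_has_vector_derivative
    by (rule has_vector_derivative_eq_rhs, rule has_vector_derivative_add,
        rule bounded_bilinear.has_vector_derivative[OF bounded_bilinear_inner w w],
        rule bounded_linear.has_vector_derivative[OF bounded_linear_mult_right],
        rule bounded_bilinear.has_vector_derivative[OF bounded_bilinear_inner z z])
      (simp add: energy_rate_def inner_commute algebra_simps)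
qed

text \<open>
  The term \<open>- w \<bullet> L w\<close> contributes \<open>- 1/2\<close> of the disagreement; half of that pays for the input.
\<close>
lemma energy_rate_le:
  assumes t: "0 \<le> t"
  shows "energy_rate t \<le> - c * dissipation t"
proof -
  let ?q = "disagreement (A (\<sigma> t)) (w t)" and ?zz = "z t \<bullet> z t"
  have q: "0 \<le> ?q" by (intro disagreement_nonneg entries t)
  have "(w t - vec mean) \<bullet> w_rate t = \<beta> * (w t \<bullet> (L t *v z t) - w t \<bullet> (L t *v w t))"
    using vec_inner_laplacian[OF t]
    by (simp add: w_rate_def inner_diff_left inner_diff_right matrix_vector_mult_diff_distrib)
  also have "\<dots> \<le> \<beta> * ((?q / 4 + N * hi * ?zz) - ?q / 2)"
    using inner_laplacian_le[OF entries(1,2)[OF t] balanced[OF t], unfolded N_eq, of "w t" "z t"] \<beta>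
      weight_balanced_inner_laplacian_self[OF balanced[OF t], of "w t"]
    by (intro mult_left_mono) auto
  finally have "energy_rate t \<le> 2 * (\<beta> * ((?q / 4 + N * hi * ?zz) - ?q / 2)) - 2 * (\<alpha> * K) * ?zz"
    by (simp add: energy_rate_def)
  also have "\<alpha> * K = \<beta> * (N * hi) + 1" using \<alpha> by (simp add: K_def)
  also have "2 * (\<beta> * ((?q / 4 + N * hi * ?zz) - ?q / 2)) - 2 * (\<beta> * (N * hi) + 1) * ?zz
      = - (\<beta> / 2 * ?q + 2 * ?zz)"
    by (simp add: field_simps)
  also have "\<dots> \<le> - (c * ?q + c * ?zz)"
    using q by (intro le_imp_neg_le add_mono mult_right_mono) (auto simp: c_def)
  finally show ?thesis by (simp add: dissipation_def algebra_simps)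
qed

lemma dissipation_ge:
  assumes t: "0 \<le> t"
  shows "disagreement (A (\<sigma> t)) (w t) \<le> dissipation t" "z t \<bullet> z t \<le> dissipation t"
    "0 \<le> dissipation t"
  using disagreement_nonneg[OF entries(1)[OF t], of "w t"] by (auto simp: dissipation_def)

text \<open>
  \<open>L (z - w)\<close> is controlled by the disagreements of \<open>w\<close> and of \<open>z\<close>. The former is part of the
  dissipation; the latter is at most \<open>4 N hi |z|\<^sup>2\<close>, whence the second factor of \<open>M\<close>.
\<close>
lemma w_rate_le:
  assumes t: "0 \<le> t"
  shows "(w_rate t $ i)\<^sup>2 \<le> M * dissipation t"
proof -
  let ?D = "disagreement (A (\<sigma> t))" and ?h = "N * hi"
  note e = entries(1,2)[OF t]
  have h: "0 \<le> ?h" using hi N_pos by simp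
  have "?D (z t - w t) \<le> 2 * (4 * ?h * (z t \<bullet> z t)) + 2 * ?D (w t)"
    using disagreement_diff_le[OF e(1), of "z t" "w t"] disagreement_le[OF e balanced[OF t], unfolded N_eq, of "z t"]
    by simp
  also have "\<dots> \<le> 2 * (4 * ?h * dissipation t) + 2 * dissipation t"
    using dissipation_ge[OF t] h by (intro add_mono mult_left_mono) auto
  finally have D: "?D (z t - w t) \<le> 2 * (1 + 4 * ?h) * dissipation t"
    by (simp add: algebra_simps)
  have "(w_rate t $ i)\<^sup>2 = \<beta>\<^sup>2 * ((L t *v (z t - w t)) $ i)\<^sup>2"
    by (simp add: w_rate_def power_mult_distrib)
  also have "\<dots> \<le> \<beta>\<^sup>2 * (?h * ?D (z t - w t))"
    using laplacian_component_le_disagreement[OF e, unfolded N_eq] by (intro mult_left_mono) auto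
  also have "\<dots> \<le> \<beta>\<^sup>2 * (?h * (2 * (1 + 4 * ?h) * dissipation t))"
    by (intro mult_left_mono D h) auto
  finally show ?thesis by (simp only: M_def mult_ac)
qed

lemma energy_antimono:
  assumes "0 \<le> a" "a \<le> b"
  shows "energy b \<le> energy a"
proof (rule nonincreasing_except_finite[OF assms(2) finite_switching_times energy_continuous[OF assms(1)]])
  fix t assume t: "t \<in> {a<..<b} - switching_times \<sigma> \<inter> {a..b}"
  then show "(energy has_real_derivative energy_rate t) (at t)"
    using assms by (intro energy_derivative) auto
  have "0 \<le> c * dissipation t" using dissipation_ge(3)[of t] t assms c_pos by auto
  then show "energy_rate t \<le> 0" using energy_rate_le[of t] t assms by auto
qed

lemma component_drift:
  assumes ab: "0 \<le> a" "a \<le> b" and x: "continuous_on {0..} x"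
    and dx: "\<And>t. 0 \<le> t \<Longrightarrow> t \<notin> switching_times \<sigma> \<Longrightarrow> (x has_vector_derivative x' t) (at t)"
    and speed: "\<And>t. 0 \<le> t \<Longrightarrow> (x' t $ i)\<^sup>2 \<le> B * dissipation t" and B: "0 \<le> B"
  shows "\<bar>x b $ i - x a $ i\<bar> \<le> sqrt (B / c * (b - a)) * sqrt (energy a - energy b)"
proof -
  have "(x b $ i - x a $ i)\<^sup>2 \<le> B / c * (b - a) * (energy a - energy b)"
  proof (rule drift_bound[OF ab(2) finite_switching_times _ energy_continuous[OF ab(1)]])
    show "continuous_on {a..b} (\<lambda>t. x t $ i)"
      using continuous_on_subset[OF x, of "{a..b}"] ab by (auto intro!: continuous_intros)
    fix t assume "t \<in> {a<..<b} - switching_times \<sigma> \<inter> {a..b}"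
    then have t: "0 \<le> t" "t \<notin> switching_times \<sigma>" using ab by auto
    show "((\<lambda>t. x t $ i) has_real_derivative x' t $ i) (at t)"
      unfolding has_real_derivative_iff_has_vector_derivative
      by (rule bounded_linear.has_vector_derivative[OF bounded_linear_vec_nth dx[OF t]])
    show "(energy has_real_derivative energy_rate t) (at t)" by (rule energy_derivative[OF t])
    have "B / c * (c * dissipation t) \<le> B / c * - energy_rate t"
      using energy_rate_le[OF t(1)] B c_pos by (intro mult_left_mono) auto
    then show "(x' t $ i)\<^sup>2 \<le> - (B / c) * energy_rate t"
      using speed[OF t(1)] c_pos by simp
  qed
  then have "sqrt ((x b $ i - x a $ i)\<^sup>2) \<le> sqrt (B / c * (b - a) * (energy a - energy b))"
    by (rule real_sqrt_le_mono)
  then show ?thesis by (simp only: real_sqrt_abs real_sqrt_mult)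
qed

text \<open>
  Between two switching times the energy is differentiable, so the mean value theorem finds a moment
  at which the dissipation is paid for by the average drop of the energy.
\<close>
lemma small_dissipation:
  assumes p: "0 \<le> p" and none: "{p<..p + tL} \<inter> switching_times \<sigma> = {}"
  obtains t where "t \<in> {p<..<p + tL}" "c * tL * dissipation t \<le> energy p - energy (p + tL)"
proof -
  have d: "(energy has_derivative (*) (energy_rate t)) (at t)" if "p < t" "t < p + tL" for t
  proof -
    have "t \<in> {p<..p + tL}" using that by auto
    then have "t \<notin> switching_times \<sigma>" using none by blast
    then show ?thesis using energy_derivative[of t] that p by (simp add: has_field_derivative_def)
  qed
  obtain t where t: "p < t" "t < p + tL" "energy (p + tL) - energy p = energy_rate t * (p + tL - p)"
    using mvt[OF _ energy_continuous[OF p] d, of "p + tL"] tL by auto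
  have "tL * energy_rate t \<le> tL * (- c * dissipation t)"
    using energy_rate_le[of t] t p tL by (intro mult_left_mono) auto
  then show ?thesis using that[of t] t by (simp add: algebra_simps)
qed

section \<open>Contraction over a jointly connected window\<close>

text \<open>
  A small drop \<open>\<delta>\<close> of the energy makes the differences across all joint edges small, although the edges
  are present at different times: each difference is small at one moment of its edge's presence, and
  components hardly move during the window. Here \<open>B\<close> bounds a difference across a joint edge and
  \<open>Bz\<close> a component of \<open>z\<close>, both at the start of the window and in units of \<open>sqrt \<delta>\<close>.
\<close>
lemma window_contraction:
  assumes s: "s \<in> switching_times \<sigma>" "s' \<in> switching_times \<sigma>" "s < s'" and T: "s' - s \<le> T"
    and sc: "strongly_connected (with_proj (joint_digraph A \<sigma> s s'))"
  defines "B \<equiv> 2 * sqrt (M / c * T) + sqrt (1 / (c * tL * lo))"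
    and "Bz \<equiv> sqrt (\<alpha>\<^sup>2 / c * T) + sqrt (1 / (c * tL))"
  shows "energy s \<le> (N * (N\<^sup>2 * B)\<^sup>2 + K * (N * Bz\<^sup>2)) * (energy s - energy s')"
proof -
  define \<delta> where "\<delta> = energy s - energy s'"
  have s0: "0 \<le> s" by (rule switching_time_nonneg[OF s(1)])
  have \<delta>: "0 \<le> \<delta>" unfolding \<delta>_def using energy_antimono[OF s0, of s'] s by simp
  have drop: "energy a - energy b \<le> \<delta>" if "s \<le> a" "a \<le> b" "b \<le> s'" for a b
    using energy_antimono[of s a] energy_antimono[of b s'] that s0 by (simp add: \<delta>_def)
  have T0: "0 < T" using s T by simp
  have B0: "0 \<le> B" unfolding B_def using M_nonneg c_pos T0 tL lo by simp
  have drift: "\<bar>x t $ i - x s $ i\<bar> \<le> sqrt (D / c * T) * sqrt \<delta>"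
    if t: "s \<le> t" "t \<le> s'" and D: "0 \<le> D"
      and le: "\<bar>x t $ i - x s $ i\<bar> \<le> sqrt (D / c * (t - s)) * sqrt (energy s - energy t)"
    for x :: "real \<Rightarrow> real^'n" and t i D
  proof -
    have "sqrt (D / c * (t - s)) * sqrt (energy s - energy t) \<le> sqrt (D / c * T) * sqrt \<delta>"
      using t T D c_pos drop[of s t] T0 energy_antimono[OF s0 t(1)]
      by (intro mult_mono real_sqrt_le_mono mult_left_mono) auto
    with le show ?thesis by linarith
  qed
  have w_drift: "\<bar>w t $ i - w s $ i\<bar> \<le> sqrt (M / c * T) * sqrt \<delta>" if "s \<le> t" "t \<le> s'" for t i
    by (rule drift[OF that M_nonneg])
      (rule component_drift[OF s0 that(1) w_continuous w_derivative w_rate_le M_nonneg])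
  have z_speed: "((- \<alpha> *\<^sub>R z t) $ i)\<^sup>2 \<le> \<alpha>\<^sup>2 * dissipation t" if "0 \<le> t" for t i
  proof -
    have "(z t $ i)\<^sup>2 \<le> z t \<bullet> z t" by (rule component_square_le_inner)
    then show ?thesis
      using dissipation_ge(2)[OF that] by (auto simp: power_mult_distrib intro!: mult_left_mono)
  qed
  have z_drift: "\<bar>z t $ i - z s $ i\<bar> \<le> sqrt (\<alpha>\<^sup>2 / c * T) * sqrt \<delta>" if "s \<le> t" "t \<le> s'" for t i
    by (rule drift[OF that zero_le_power2])
      (rule component_drift[OF s0 that(1) z_continuous z_derivative z_speed zero_le_power2])
  have edge: "\<bar>w s $ i - w s $ j\<bar> \<le> B * sqrt \<delta>" if "(i, j) \<in> parcs (joint_digraph A \<sigma> s s')" for i j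
  proof -
    obtain t0 where t0: "s \<le> t0" "t0 < s'" "0 < A (\<sigma> t0) $ i $ j"
      using \<open>(i, j) \<in> _\<close> by (auto simp: joint_digraph_def digraph_of_def)
    obtain p where p: "s \<le> p" "p + tL < s'" "{p<..p + tL} \<inter> switching_times \<sigma> = {}"
      and const: "\<And>x. x \<in> {p..p + tL} \<Longrightarrow> \<sigma> x = \<sigma> t0"
      using signal_value_persists[OF signal dwell tL s(1,2) t0(1,2)] by metis
    have p0: "0 \<le> p" using p s0 by simp
    obtain t where t: "t \<in> {p<..<p + tL}" "c * tL * dissipation t \<le> energy p - energy (p + tL)"
      using small_dissipation[OF p0 p(3)] .
    have t': "0 \<le> t" "s \<le> t" "t \<le> s'" using t p s0 by auto
    have \<sigma>t: "\<sigma> t = \<sigma> t0" using const t by auto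
    have "lo * (w t $ i - w t $ j)\<^sup>2 \<le> A (\<sigma> t) $ i $ j * (w t $ i - w t $ j)\<^sup>2"
      using entries(3)[OF t'(1)] t0 \<sigma>t by (intro mult_right_mono) auto
    also have "\<dots> \<le> dissipation t"
      using edge_le_disagreement[OF entries(1)[OF t'(1)]] dissipation_ge(1)[OF t'(1)] by (rule order_trans)
    finally have "c * tL * (lo * (w t $ i - w t $ j)\<^sup>2) \<le> c * tL * dissipation t"
      using c_pos tL by (intro mult_left_mono) auto
    also have "\<dots> \<le> \<delta>" using t drop[of p "p + tL"] p tL by linarith
    finally have "(w t $ i - w t $ j)\<^sup>2 \<le> 1 / (c * tL * lo) * \<delta>"
      using c_pos tL lo by (simp add: pos_le_divide_eq mult_ac)
    then have "sqrt ((w t $ i - w t $ j)\<^sup>2) \<le> sqrt (1 / (c * tL * lo) * \<delta>)" by (rule real_sqrt_le_mono)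
    then have "\<bar>w t $ i - w t $ j\<bar> \<le> sqrt (1 / (c * tL * lo)) * sqrt \<delta>"
      by (simp only: real_sqrt_abs real_sqrt_mult)
    then have "\<bar>w s $ i - w s $ j\<bar>
        \<le> 2 * (sqrt (M / c * T) * sqrt \<delta>) + sqrt (1 / (c * tL * lo)) * sqrt \<delta>"
      using w_drift[OF t'(2,3), of i] w_drift[OF t'(2,3), of j] by linarith
    then show ?thesis by (simp add: B_def algebra_simps)
  qed
  define R where "R = N\<^sup>2 * B"
  have spread: "\<bar>w s $ i - w s $ j\<bar> \<le> R * sqrt \<delta>" for i j
  proof -
    have "\<bar>w s $ i - w s $ j\<bar> \<le> real CARD('n \<times> 'n) * (B * sqrt \<delta>)"
      using B0 \<delta> edge
      by (intro strongly_connected_spread_bound[OF sc, where x = "\<lambda>i. w s $ i"])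
        (auto simp: joint_digraph_def)
    then show ?thesis by (simp add: R_def N_eq power2_eq_square mult.assoc)
  qed
  have dev: "(w s $ i - mean)\<^sup>2 \<le> R\<^sup>2 * \<delta>" for i
  proof -
    have "N * \<bar>w s $ i - mean\<bar> = \<bar>\<Sum>j\<in>UNIV. w s $ i - w s $ j\<bar>"
      using sum_w[OF s0] N_pos by (simp add: sum_subtractf N_eq abs_mult flip: right_diff_distrib)
    also have "\<dots> \<le> (\<Sum>j\<in>UNIV. \<bar>w s $ i - w s $ j\<bar>)" by (rule sum_abs)
    also have "\<dots> \<le> N * (R * sqrt \<delta>)" unfolding N_eq[symmetric] using spread by (rule sum_bounded_above)
    finally have "\<bar>w s $ i - mean\<bar> \<le> R * sqrt \<delta>" by (simp add: mult_le_cancel_left_pos N_pos)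
    then have "\<bar>w s $ i - mean\<bar>\<^sup>2 \<le> (R * sqrt \<delta>)\<^sup>2" by (rule power_mono) simp
    then show ?thesis using \<delta> by (simp add: power_mult_distrib)
  qed
  have zdev: "(z s $ i)\<^sup>2 \<le> Bz\<^sup>2 * \<delta>" for i
  proof -
    have none: "{s<..s + tL} \<inter> switching_times \<sigma> = {}" and s': "s + tL < s'"
      using dwell s by (force simp: has_dwell_time_def)+
    obtain t where t: "t \<in> {s<..<s + tL}" "c * tL * dissipation t \<le> energy s - energy (s + tL)"
      using small_dissipation[OF s0 none] .
    have "(z t $ i)\<^sup>2 \<le> z t \<bullet> z t" by (rule component_square_le_inner)
    also have "\<dots> \<le> dissipation t" using dissipation_ge(2)[of t] t s0 by auto
    finally have "c * tL * (z t $ i)\<^sup>2 \<le> c * tL * dissipation t"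
      using c_pos tL by (intro mult_left_mono) auto
    also have "\<dots> \<le> \<delta>" using t drop[of s "s + tL"] s' tL by linarith
    finally have "(z t $ i)\<^sup>2 \<le> 1 / (c * tL) * \<delta>"
      using c_pos tL by (simp add: pos_le_divide_eq mult_ac)
    then have "sqrt ((z t $ i)\<^sup>2) \<le> sqrt (1 / (c * tL) * \<delta>)" by (rule real_sqrt_le_mono)
    then have "\<bar>z t $ i\<bar> \<le> sqrt (1 / (c * tL)) * sqrt \<delta>"
      by (simp only: real_sqrt_abs real_sqrt_mult)
    then have "\<bar>z s $ i\<bar> \<le> sqrt (\<alpha>\<^sup>2 / c * T) * sqrt \<delta> + sqrt (1 / (c * tL)) * sqrt \<delta>"
      using z_drift[of t i] t s' by force
    then have "\<bar>z s $ i\<bar> \<le> Bz * sqrt \<delta>" by (simp add: Bz_def algebra_simps)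
    then have "\<bar>z s $ i\<bar>\<^sup>2 \<le> (Bz * sqrt \<delta>)\<^sup>2" by (rule power_mono) simp
    then show ?thesis using \<delta> by (simp add: power_mult_distrib)
  qed
  have "(w s - vec mean) \<bullet> (w s - vec mean) \<le> N * (R\<^sup>2 * \<delta>)"
    using inner_self_le[of "w s - vec mean" "R\<^sup>2 * \<delta>"] dev by (simp add: N_eq)
  moreover have "z s \<bullet> z s \<le> N * (Bz\<^sup>2 * \<delta>)"
    using inner_self_le[of "z s" "Bz\<^sup>2 * \<delta>"] zdev by (simp add: N_eq)
  then have "K * (z s \<bullet> z s) \<le> K * (N * (Bz\<^sup>2 * \<delta>))" using K_pos by (intro mult_left_mono) auto
  ultimately have "energy s \<le> N * (R\<^sup>2 * \<delta>) + K * (N * (Bz\<^sup>2 * \<delta>))" by (simp add: energy_def)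
  then show ?thesis by (simp add: R_def \<delta>_def algebra_simps)
qed

section \<open>Exponential convergence\<close>

lemma energy_decays:
  assumes "recurrently_jointly_connected A \<sigma>"
  obtains C r where "0 < r" "\<And>t. 0 \<le> t \<Longrightarrow> energy t \<le> C * exp (- r * t)"
proof -
  obtain \<tau> T where \<tau>: "\<tau> 0 = 0" "\<And>j. \<tau> j \<in> switching_times \<sigma>" "\<And>j. \<tau> j < \<tau> (Suc j)"
    and T: "\<And>j. \<tau> (Suc j) - \<tau> j \<le> T"
    and sc: "\<And>j. strongly_connected (with_proj (joint_digraph A \<sigma> (\<tau> j) (\<tau> (Suc j))))"
    using assms unfolding recurrently_jointly_connected_def by blast
  define B where "B = 2 * sqrt (M / c * T) + sqrt (1 / (c * tL * lo))"
  define Bz where "Bz = sqrt (\<alpha>\<^sup>2 / c * T) + sqrt (1 / (c * tL))"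
  define \<kappa> where "\<kappa> = N * (N\<^sup>2 * B)\<^sup>2 + K * (N * Bz\<^sup>2)"
  have T0: "0 < T" using T[of 0] \<tau>(3)[of 0] by linarith
  have "0 < Bz" unfolding Bz_def using T0 c_pos tL by (intro add_nonneg_pos) auto
  then have \<kappa>: "0 < \<kappa>" unfolding \<kappa>_def using K_pos N_pos by (intro add_nonneg_pos mult_pos_pos) auto
  \<comment> \<open>\<open>W \<le> \<kappa> (W - W\<^sub>1)\<close> for the next value \<open>W\<^sub>1\<close> gives the factor \<open>1 - 1 / \<kappa>\<close>; raising \<open>\<kappa>\<close> by one
    keeps it positive.\<close>
  define \<rho> where "\<rho> = \<kappa> / (\<kappa> + 1)"
  have \<rho>: "0 < \<rho>" "\<rho> < 1" using \<kappa> by (auto simp: \<rho>_def)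
  have mono: "energy t \<le> energy s" if "0 \<le> s" "s \<le> t" for s t
    using energy_antimono that .
  have contract: "energy (\<tau> (Suc j)) \<le> \<rho> * energy (\<tau> j)" for j
  proof -
    have "energy (\<tau> j) \<le> \<kappa> * (energy (\<tau> j) - energy (\<tau> (Suc j)))"
      unfolding \<kappa>_def B_def Bz_def
      by (rule window_contraction[OF \<tau>(2) \<tau>(2) \<tau>(3) T sc])
    moreover have "energy (\<tau> (Suc j)) \<le> energy (\<tau> j)"
      using energy_antimono[OF switching_time_nonneg[OF \<tau>(2)]] \<tau>(3)[of j] by simp
    ultimately show ?thesis using \<kappa> by (simp add: \<rho>_def field_simps)
  qed
  have "j * tL \<le> \<tau> j" for j
  proof (induction j)
    case (Suc j)
    have "tL < \<tau> (Suc j) - \<tau> j" using dwell \<tau> by (auto simp: has_dwell_time_def)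
    with Suc show ?case by (simp add: algebra_simps)
  qed (simp add: \<tau>)
  then have unbounded: "\<exists>j. t < \<tau> j" for t
    using ex_less_of_nat_mult[OF tL, of t] by (meson less_le_trans)
  have E0: "0 \<le> energy 0" unfolding energy_def using K_pos by auto
  show ?thesis
  proof (rule that)
    show "0 < - ln \<rho> / T" using \<rho> T0 by (intro divide_pos_pos) auto
    show "energy t \<le> energy 0 / \<rho> * exp (- (- ln \<rho> / T) * t)" if "0 \<le> t" for t
      by (rule exponential_decay_from_windows[OF \<tau>(1,3) T unbounded \<rho> contract mono E0 that])
  qed
qed

lemma components_le_energy:
  shows "(w t $ i - mean)\<^sup>2 \<le> energy t" and "(z t $ i)\<^sup>2 \<le> energy t / K"
proof -
  note comp = component_square_le_inner[of _ i]
  show "(w t $ i - mean)\<^sup>2 \<le> energy t"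
    using comp[of "w t - vec mean"] K_pos by (simp add: energy_def add_increasing2)
  have "K * (z t $ i)\<^sup>2 \<le> K * (z t \<bullet> z t)" using comp K_pos by (intro mult_left_mono) auto
  also have "\<dots> \<le> energy t" by (simp add: energy_def)
  finally show "(z t $ i)\<^sup>2 \<le> energy t / K" using K_pos by (simp add: pos_le_divide_eq mult.commute)
qed

lemma consensus:
  assumes "recurrently_jointly_connected A \<sigma>"
  shows "tends_exponentially_fast (\<lambda>t. y t $ i) (- mean / \<alpha>)"
    and "tends_exponentially_fast (\<lambda>t. w t $ i) mean"
proof -
  obtain C r where r: "0 < r" and le: "\<And>t. 0 \<le> t \<Longrightarrow> energy t \<le> C * exp (- r * t)"
    using energy_decays[OF assms] by blast
  show "tends_exponentially_fast (\<lambda>t. w t $ i) mean"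
    by (rule tends_exponentially_fast_squareI[OF r])
      (rule order_trans[OF components_le_energy(1) le])
  define D where "D = 2 * (1 / K + 1) / \<alpha>\<^sup>2"
  have D: "0 \<le> D" unfolding D_def using K_pos by simp
  show "tends_exponentially_fast (\<lambda>t. y t $ i) (- mean / \<alpha>)"
  proof (rule tends_exponentially_fast_squareI[OF r])
    fix t :: real assume t: "0 \<le> t"
    have sq: "(a - b)\<^sup>2 \<le> 2 * (a\<^sup>2 + b\<^sup>2)" for a b :: real
      using zero_le_power2[of "a + b"] by (simp add: power2_eq_square algebra_simps)
    have "y t $ i - - mean / \<alpha> = (z t $ i - (w t $ i - mean)) / \<alpha>"
      using \<alpha> by (simp add: z_def field_simps)
    then have "(y t $ i - - mean / \<alpha>)\<^sup>2 = (z t $ i - (w t $ i - mean))\<^sup>2 / \<alpha>\<^sup>2"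
      by (simp add: power_divide)
    also have "\<dots> \<le> 2 * (energy t / K + energy t) / \<alpha>\<^sup>2"
    proof (rule divide_right_mono)
      show "(z t $ i - (w t $ i - mean))\<^sup>2 \<le> 2 * (energy t / K + energy t)"
        by (rule order_trans[OF sq]) (intro mult_left_mono add_mono components_le_energy; simp)
    qed simp
    also have "\<dots> = D * energy t" by (simp add: D_def algebra_simps)
    also have "\<dots> \<le> D * (C * exp (- r * t))" using le[OF t] D by (rule mult_left_mono)
    finally show "(y t $ i - - mean / \<alpha>)\<^sup>2 \<le> D * C * exp (- r * t)" by (simp add: mult.assoc)
  qed
qed

end

theorem lemma4p4:
  fixes m :: enat
    and A :: "nat \<Rightarrow> real^'n^'n"
    and a_lo a_hi \<alpha> \<beta> :: real
    and S :: "(real \<Rightarrow> nat) set"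
    and \<sigma> :: "real \<Rightarrow> nat"
    and y w :: "real \<Rightarrow> real^'n"
  assumes "CARD('n) \<ge> 2"
    and "0 < a_lo" and "a_lo \<le> a_hi"
    and "adjacency_family (index_set m) a_lo a_hi A"
    and "admissible_switching_set (index_set m) A S"
    and "\<sigma> \<in> S"
    and "\<alpha> > 0" and "\<beta> > 0"
    and "is_trajectory \<alpha> \<beta> A \<sigma> y w"
  shows "\<forall>i. tends_exponentially_fast (\<lambda>t. y t $ i)
               (- (inverse \<alpha> / real CARD('n)) * (\<Sum>j\<in>UNIV. w 0 $ j)) \<and>
             tends_exponentially_fast (\<lambda>t. w t $ i)
               ((1 / real CARD('n)) * (\<Sum>j\<in>UNIV. w 0 $ j))"
proof -
  obtain tL where tL: "0 < tL" and \<sigma>: "switching_signal (index_set m) \<sigma>" "has_dwell_time tL \<sigma>"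
    "\<forall>t\<ge>0. weight_balanced (A (\<sigma> t))" "recurrently_jointly_connected A \<sigma>"
    using assms(5,6) unfolding admissible_switching_set_def by blast
  interpret switched_consensus "index_set m" A \<sigma> "real CARD('n)" a_lo a_hi tL \<alpha> \<beta> y w
    by unfold_locales (use assms tL \<sigma> in auto)
  show ?thesis
    using consensus[OF \<sigma>(4)] by (simp add: mean_def divide_inverse mult_ac)
qed

end
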